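(* Let $T$ be a tree with $n\geq 2$ vertices. Let $k$ and $i$ be nonnegative integers with $0\leq i\leq 2k$ and $n=k^2+i$. For any $v\in C(T)$, \[\frac{\operatorname{Ecc}(T)}{\operatorname{ecc}_T(v)} \geq \begin{cases} n-3+2k+\frac{i}{k} & \text{if } 0\leq i\leq k,\\ n-3+2k+\frac{i+1}{k+1} & \text{if } k+1\leq i\leq 2k.\end{cases}\] For $n\geq 4$, equality holds if and only if $T$ is a tree whose longest path has $2x$ vertices, where $x=k$ in the first case and $x=k+1$ in the second case, and every vertex not on this path is adjacent to one of the two center vertices of this path. For $i=k$ the two bounds agree and both values of $x$ give an extremal tree.
   Context: For a vertex $v$ of a tree $T$, $\operatorname{ecc}_T(v)=\max_{u\in V(T)} d_T(u,v)$. The total eccentricity is $\operatorname{Ecc}(T)=\sum_{z\in V(T)}\operatorname{ecc}_T(z)$. The center $C(T)$ is the set of vertices of minimum eccentricity. *)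

theory Defs
  imports "Graph_Theory.Graph_Theory" Complex_Main
begin

text \<open>
  A finite simple undirected graph is a \<^locale>\<open>pair_graph\<close>: a loop-free symmetric digraph
  in which each undirected edge is the two arcs \<open>(u, v)\<close> and \<open>(v, u)\<close>.

  The library predicate \<^const>\<open>tree\<close> cannot be used for such graphs: it forbids all directed
  cycles, and so also the closed walk \<open>u, v, u\<close> along a single edge. A cycle of an undirected
  graph is a directed cycle of length at least 3.
\<close>

definition tree_graph :: "'a pair_pre_digraph \<Rightarrow> bool" where
  "tree_graph T \<longleftrightarrow>
     pair_graph T \<and> connected (with_proj T) \<and>
     \<not> (\<exists>c. pre_digraph.cycle (with_proj T) c \<and> length c \<ge> 3)"

text \<open>
  The distance is the least cost of a walk when every arc has weight 1. It is \<open>\<infinity>\<close> only between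
  vertices in different components, so in a tree \<^const>\<open>real_of_ereal\<close> loses nothing.
\<close>

definition gdist :: "'a pair_pre_digraph \<Rightarrow> 'a \<Rightarrow> 'a \<Rightarrow> real" where
  "gdist T u v = real_of_ereal (wf_digraph.\<mu> (with_proj T) (\<lambda>_. 1) u v)"

definition ecc :: "'a pair_pre_digraph \<Rightarrow> 'a \<Rightarrow> real" where
  "ecc T v = Max ((\<lambda>u. gdist T u v) ` pverts T)"

definition total_ecc :: "'a pair_pre_digraph \<Rightarrow> real" where
  "total_ecc T = (\<Sum>z\<in>pverts T. ecc T z)"

definition center :: "'a pair_pre_digraph \<Rightarrow> 'a set" where
  "center T = {v \<in> pverts T. \<forall>u \<in> pverts T. ecc T v \<le> ecc T u}"

definition longest_path :: "'a pair_pre_digraph \<Rightarrow> 'a list \<Rightarrow> bool" where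
  "longest_path T p \<longleftrightarrow>
     vpath p (with_proj T) \<and> (\<forall>q. vpath q (with_proj T) \<longrightarrow> length q \<le> length p)"

text \<open>
  Paths are lists of vertices indexed from 0, so the two center vertices of a path on \<open>2 * x\<close>
  vertices are \<open>p ! (x - 1)\<close> and \<open>p ! x\<close>.
\<close>

definition extremal_shape :: "'a pair_pre_digraph \<Rightarrow> nat \<Rightarrow> bool" where
  "extremal_shape T x \<longleftrightarrow>
     (\<exists>p. longest_path T p \<and> length p = 2 * x \<and>
        (\<forall>w \<in> pverts T - set p. (w, p ! (x - 1)) \<in> parcs T \<or> (w, p ! x) \<in> parcs T))"

definition ratio_bound :: "nat \<Rightarrow> nat \<Rightarrow> nat \<Rightarrow> real" where
  "ratio_bound n k i =
     (if i \<le> k then real n - 3 + 2 * real k + real i / real k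
      else real n - 3 + 2 * real k + (real i + 1) / (real k + 1))"

end

(*
  Let p be a longest path and x = length p div 2, the radius of T. Every vertex w hangs off p at
  some vertex p ! j, at a height h with h <= j and h + j < length p, and then its distance to
  p ! m is h + |j - m|. Hence ecc (p ! m) = max m (length p - 1 - m), every vertex off p has
  eccentricity at least x + 1, and the center has eccentricity x. Summing up gives
  Ecc(T) / x >= n - 3 + x + n / x. Equality forces length p = 2 * x and ecc w = x + 1 for every w
  off p, that is, h = 1 and p ! j one of the two center vertices. It remains to minimize
  x + n / x over the positive integers: for n = k^2 + i the minimum is at x = k if i <= k and
  at x = k + 1 if i >= k.
*)

theory Submission
  imports Defs
begin

section \<open>Distances in trees\<close>

lemma vwalk_arcs_eq_zip: "vwalk_arcs p = zip p (tl p)"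
  by (induction p rule: vwalk_arcs.induct) auto

lemma set_vwalk_arcs: "set (vwalk_arcs p) = {(p ! i, p ! Suc i) |i. Suc i < length p}"
proof -
  have "i < length (tl p) \<longleftrightarrow> Suc i < length p" for i by auto
  then show ?thesis by (auto simp: vwalk_arcs_eq_zip set_zip nth_tl)
qed

lemma vpath_iff_nth:
  "vpath p (with_proj G) \<longleftrightarrow> p \<noteq> [] \<and> distinct p \<and> set p \<subseteq> pverts G
     \<and> (\<forall>i. Suc i < length p \<longrightarrow> (p ! i, p ! Suc i) \<in> parcs G)"
  unfolding vpath_def vwalk_def set_vwalk_arcs by auto

lemma vwalk_appendI:
  assumes "vwalk p G" "vwalk q G" "(last p, hd q) \<in> arcs_ends G"
  shows "vwalk (p @ q) G"
  using assms by (auto simp: vwalk_def vwalk_arcs_append)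

lemma (in pair_wf_digraph) awalk_vwalk_arcs:
  assumes "vwalk p (with_proj G)"
  shows "awalk (hd p) (vwalk_arcs p) (last p)" "awalk_verts (hd p) (vwalk_arcs p) = p"
  using assms by (induction p rule: vwalk_arcs.induct) (auto simp: awalk_Nil_iff awalk_Cons_iff)

lemma vpath_appendD1: "vpath (p @ q) G \<Longrightarrow> p \<noteq> [] \<Longrightarrow> vpath p G"
  by (auto simp: vpath_def intro: vwalkI_append_l)

lemma vpath_appendD2: "vpath (p @ q) G \<Longrightarrow> q \<noteq> [] \<Longrightarrow> vpath q G"
  by (auto simp: vpath_def intro: vwalkI_append_r)

lemma vpath_join:
  assumes "vpath (p @ [x]) G" "vpath (x # q) G" "set p \<inter> set q = {}"
  shows "vpath (p @ x # q) G"
  using vwalk_joinI_vwalk'[of "p @ [x]" G "x # q"] assms by (auto simp: vpath_def vwalk_join_def)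

section \<open>Uniqueness of paths in undirected trees\<close>

locale undirected_tree = pair_graph +
  assumes connected: "connected (with_proj G)"
    and cycle_length: "cycle c \<Longrightarrow> length c < 3"

lemma tree_graph_iff_undirected_tree: "tree_graph T \<longleftrightarrow> undirected_tree T"
  by (auto simp: tree_graph_def undirected_tree_def undirected_tree_axioms_def not_le)

context undirected_tree
begin

lemma vpath_rev:
  assumes "vpath p (with_proj G)" shows "vpath (rev p) (with_proj G)"
  using assms sym_arcs by (auto simp: vpath_def intro: vwalk_rev_ex)

lemma ex_vpath:
  assumes "u \<in> pverts G" "v \<in> pverts G"
  obtains p where "vpath p (with_proj G)" "hd p = u" "last p = v"
proof -
  have "u \<rightarrow>\<^sup>*\<^bsub>with_proj G\<^esub> v"
    using connected assms sym_arcs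
    by (simp add: connected_def strongly_connected_def reachable_mk_symmetric_eq)
  then show ?thesis using that by (auto simp: reachable_vpath_conv)
qed

text \<open>The closed walk has \<open>length xs + 1\<close> arcs. The bound 2 leaves room for going
  back and forth along one edge, which \<open>cycle\<close> counts as a cycle.\<close>

lemma no_vwalk_cycle:
  assumes "vwalk (u # xs @ [u]) (with_proj G)" "distinct (u # xs)"
  shows "length xs < 2"
proof -
  let ?c = "u # xs @ [u]"
  have "cycle (vwalk_arcs ?c)"
    unfolding cycle_def using awalk_vwalk_arcs[OF assms(1)] assms(2)
    by (intro exI[of _ u]) auto
  then have "length (vwalk_arcs ?c) < 3" by (rule cycle_length)
  then show ?thesis by (simp add: vwalk_arcs_eq_zip)
qed

text \<open>Induction strips the common first vertex; two paths that leave it along different edges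
  would enclose a cycle.\<close>

lemma vpath_unique:
  assumes "vpath p (with_proj G)" "vpath q (with_proj G)" "hd p = hd q" "last p = last q"
  shows "p = q"
  using assms
proof (induction p arbitrary: q)
  case Nil
  then show ?case by auto
next
  case (Cons u ps)
  then obtain qs where q: "q = u # qs"
    by (cases q) (auto simp: vpath_def)
  consider "ps = []" | "qs = []" | "ps \<noteq> []" "qs \<noteq> []" by blast
  then show ?case
  proof cases
    case 1
    then show ?thesis using Cons.prems q by (cases "qs = []") (auto simp: vpath_def)
  next
    case 2
    then show ?thesis using Cons.prems q by (cases "ps = []") (auto simp: vpath_def)
  next
    case 3
    have walks: "vpath ps (with_proj G)" "vpath qs (with_proj G)"
      "(u, hd ps) \<in> parcs G" "(u, hd qs) \<in> parcs G"
      using Cons.prems(1,2) 3 unfolding q by (auto simp: vpath_def elim: vwalk_consE)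
    have dist: "u \<notin> set ps" "u \<notin> set qs" "distinct ps" "distinct qs"
      using Cons.prems(1,2) unfolding q by (auto simp: vpath_def)
    show ?thesis
    proof (cases "hd ps = hd qs")
      case True
      then show ?thesis using Cons.IH[OF walks(1,2)] Cons.prems 3 q by simp
    next
      case False
      \<comment> \<open>Cut at the first common vertex after \<open>u\<close>, the two paths close up to a cycle.\<close>
      have "\<exists>w \<in> set ps. w \<in> set qs"
        using Cons.prems(4) 3 q by (metis last_ConsR last_in_set)
      then obtain ps1 w ps2 where ps: "ps = ps1 @ w # ps2" "w \<in> set qs" "\<forall>x \<in> set ps1. x \<notin> set qs"
        using split_list_first_prop[of ps "\<lambda>x. x \<in> set qs"] by blast
      obtain qs1 qs2 where qs: "qs = qs1 @ w # qs2"
        using ps(2) by (meson split_list)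
      have p1: "vpath (ps1 @ [w]) (with_proj G)"
        using walks(1) ps(1) vpath_appendD1[of "ps1 @ [w]" ps2] by simp
      have q1: "vpath (rev (qs1 @ [w])) (with_proj G)"
        using walks(2) qs vpath_appendD1[of "qs1 @ [w]" qs2] by (intro vpath_rev) simp
      have "vpath (ps1 @ w # rev qs1) (with_proj G)"
        using p1 q1 ps(3) qs by (intro vpath_join[OF p1]) auto
      then have "vwalk (ps1 @ w # rev qs1) (with_proj G)" by (simp add: vpath_def)
      moreover have "hd (ps1 @ w # rev qs1) = hd ps" "last (ps1 @ w # rev qs1) = hd qs"
        unfolding ps(1) qs by (cases ps1; simp) (cases qs1; simp)
      ultimately have "vwalk ((u # ps1 @ w # rev qs1) @ [u]) (with_proj G)"
        using walks(3,4) arcs_symmetric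
        by (intro vwalk_appendI) (auto intro!: vwalk_consI dest: in_arcsD1)
      moreover have "distinct (u # ps1 @ w # rev qs1)"
        using dist ps qs by auto
      ultimately have "length (ps1 @ w # rev qs1) < 2"
        using no_vwalk_cycle[of u "ps1 @ w # rev qs1"] by simp
      \<comment> \<open>So \<open>ps1\<close> and \<open>qs1\<close> are both empty and
        \<open>w\<close> heads both \<open>ps\<close> and \<open>qs\<close>, against
        \<open>False\<close>.\<close>
      then show ?thesis using False ps(1) qs by (cases ps1; cases qs1) auto
    qed
  qed
qed

section \<open>Distances and eccentricities via unique paths\<close>

lemma dist_vpath:
  assumes p: "vpath p (with_proj G)"
  shows "\<mu> (\<lambda>_. 1) (hd p) (last p) = ereal (real (length p - 1))"
    and "gdist G (hd p) (last p) = real (length p - 1)"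
proof -
  have "hd p \<rightarrow>\<^sup>*\<^bsub>with_proj G\<^esub> last p" using p reachable_vpath_conv by auto
  \<comment> \<open>A cheapest walk can be taken to be a path; by uniqueness it visits exactly the
    vertices of \<open>p\<close>.\<close>
  then obtain a where a: "apath (hd p) a (last p)" "\<mu> (\<lambda>_. 1) (hd p) (last p) = awalk_cost (\<lambda>_. 1) a"
    using min_cost_awalk[of "hd p" "last p" "\<lambda>_. 1"] by auto
  have "vpath (awalk_verts (hd p) a) (with_proj G)"
    using a(1) awalk_imp_vwalk by (auto simp: apath_def vpath_def)
  moreover have "hd (awalk_verts (hd p) a) = hd p" "last (awalk_verts (hd p) a) = last p"
    using a(1) by (auto simp: apath_def)
  ultimately have "awalk_verts (hd p) a = p" using p by (intro vpath_unique)
  then have "length a = length p - 1"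
    using length_awalk_verts[of "hd p" a] by simp
  then show "\<mu> (\<lambda>_. 1) (hd p) (last p) = ereal (real (length p - 1))"
    using a(2) by (simp add: awalk_cost_def sum_list_triv)
  then show "gdist G (hd p) (last p) = real (length p - 1)"
    by (simp add: gdist_def)
qed

text \<open>Stated for walks because a path extended by a neighbour of its first vertex, as in
  \<open>gdist_adjacent_le\<close>, may repeat a vertex.\<close>

lemma gdist_vwalk_le:
  assumes "vwalk p (with_proj G)"
  shows "gdist G (hd p) (last p) \<le> real (length p - 1)"
proof -
  obtain q where q: "vpath q (with_proj G)" "hd q = hd p" "last q = last p"
    using assms vwalk_imp_ex_vpath by metis
  have "\<mu> (\<lambda>_. 1) (hd p) (last p) \<le> awalk_cost (\<lambda>_. 1) (vwalk_arcs p)"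
    using awalk_vwalk_arcs(1)[OF assms] by (rule min_cost_le_walk_cost)
  also have "awalk_cost (\<lambda>_. 1) (vwalk_arcs p) = real (length p - 1)"
    by (simp add: awalk_cost_def sum_list_triv vwalk_arcs_eq_zip)
  finally show ?thesis using dist_vpath[OF q(1)] q(2,3) by simp
qed

lemma gdist_sym:
  assumes "u \<in> pverts G" "v \<in> pverts G"
  shows "gdist G u v = gdist G v u"
proof -
  obtain p where p: "vpath p (with_proj G)" "hd p = u" "last p = v"
    using ex_vpath assms .
  then show ?thesis
    using dist_vpath(2)[OF p(1)] dist_vpath(2)[OF vpath_rev[OF p(1)]]
    by (simp add: hd_rev last_rev)
qed

lemma gdist_vpath_nth:
  assumes "vpath p (with_proj G)" "i < length p"
  shows "gdist G (hd p) (p ! i) = real i"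
proof -
  have "vpath (take (Suc i) p) (with_proj G)"
    using assms vpath_appendD1[of "take (Suc i) p" "drop (Suc i) p"] by (cases p) auto
  moreover have "hd (take (Suc i) p) = hd p" "last (take (Suc i) p) = p ! i"
    using assms(2) by (simp add: hd_take, simp add: take_Suc_conv_app_nth)
  ultimately show ?thesis using dist_vpath(2)[of "take (Suc i) p"] assms(2) by simp
qed

lemma gdist_adjacent_le:
  assumes "(w, c) \<in> parcs G" "z \<in> pverts G"
  shows "gdist G w z \<le> gdist G c z + 1"
proof -
  obtain p where p: "vpath p (with_proj G)" "hd p = c" "last p = z"
    using ex_vpath assms in_arcsD2 by metis
  have "p \<noteq> []" "vwalk (w # p) (with_proj G)"
    using p assms(1) by (auto simp: vpath_def intro!: vwalk_consI dest: in_arcsD1)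
  then show ?thesis
    using gdist_vwalk_le[of "w # p"] dist_vpath(2)[OF p(1)] p(2,3) by (cases p) auto
qed

lemma gdist_le_ecc: "u \<in> pverts G \<Longrightarrow> gdist G u v \<le> ecc G v"
  unfolding ecc_def using pair_finite_verts by (intro Max_ge) auto

lemma pverts_nonempty: "pverts G \<noteq> {}"
  using connected by (simp add: connected_def strongly_connected_def)

lemma ecc_le_iff: "ecc G v \<le> b \<longleftrightarrow> (\<forall>u \<in> pverts G. gdist G u v \<le> b)"
  unfolding ecc_def using pair_finite_verts pverts_nonempty by (subst Max_le_iff) auto

lemma ecc_adjacent_le:
  assumes "(w, c) \<in> parcs G"
  shows "ecc G w \<le> ecc G c + 1"
  unfolding ecc_le_iff
proof
  fix z assume z: "z \<in> pverts G"
  have "gdist G w z \<le> gdist G z c + 1"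
    using gdist_adjacent_le[OF assms z] gdist_sym[of c z] assms z in_arcsD2 by auto
  also have "gdist G z c \<le> ecc G c" using z by (rule gdist_le_ecc)
  finally show "gdist G z w \<le> ecc G c + 1"
    using gdist_sym[of w z] assms z in_arcsD1 by auto
qed

section \<open>Eccentricities relative to a longest path\<close>

lemma longest_path_exists:
  obtains p where "longest_path G p"
proof -
  obtain u where "u \<in> pverts G" using pverts_nonempty by auto
  then have "vpath [u] (with_proj G)" by (simp add: vpath_def)
  moreover have "length q < Suc (card (pverts G))" if "vpath q (with_proj G)" for q
    using that pair_finite_verts
    by (auto simp: vpath_iff_nth less_Suc_eq_le intro: card_mono simp flip: distinct_card)
  ultimately show ?thesis
    using ex_has_greatest_nat[of "\<lambda>q. vpath q (with_proj G)" "[u]" length "Suc (card (pverts G))"] that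
    by (auto simp: longest_path_def)
qed

text \<open>The path from \<open>w\<close> to \<open>hd p\<close> first meets \<open>p\<close> at
  position \<open>j\<close>, after \<open>h\<close> edges. Both inequalities come from maximality of
  \<open>p\<close>: replacing the part of \<open>p\<close> before or after the junction by this
  branch cannot give a longer path.\<close>

lemma attach_to_longest_path:
  assumes p: "longest_path G p" and w: "w \<in> pverts G"
  obtains j h where "h \<le> j" "h + j < length p"
    "\<And>m. m < length p \<Longrightarrow> gdist G w (p ! m) = real h + \<bar>real j - real m\<bar>"
    "h = 0 \<Longrightarrow> w = p ! j" "h = 1 \<Longrightarrow> (w, p ! j) \<in> parcs G"
proof -
  have vp: "vpath p (with_proj G)" using p by (simp add: longest_path_def)
  then have pne: "p \<noteq> []" and hdp: "hd p \<in> pverts G" by (auto simp: vpath_iff_nth)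
  obtain q where q: "vpath q (with_proj G)" "hd q = w" "last q = hd p"
    using ex_vpath[OF w hdp] .
  have "\<exists>y \<in> set q. y \<in> set p"
    using q pne by (metis last_in_set hd_in_set vpath_iff_nth)
  then obtain q1 x q2 where q12: "q = q1 @ x # q2" "x \<in> set p" "\<forall>y \<in> set q1. y \<notin> set p"
    using split_list_first_prop[of q "\<lambda>y. y \<in> set p"] by blast
  obtain a b where ab: "p = a @ x # b" using q12(2) by (meson split_list)
  have qx: "vpath (q1 @ [x]) (with_proj G)"
    using q(1) q12(1) vpath_appendD1[of "q1 @ [x]" q2] by simp
  have right: "vpath (q1 @ x # b) (with_proj G)"
    using qx vpath_appendD2[of a "x # b"] vp q12(3) ab by (auto intro!: vpath_join[OF qx])
  have "vpath (rev (a @ [x])) (with_proj G)"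
    using vp ab vpath_appendD1[of "a @ [x]" b] by (intro vpath_rev) simp
  then have left: "vpath (q1 @ x # rev a) (with_proj G)"
    using qx q12(3) ab by (auto intro!: vpath_join[OF qx])
  have hds: "hd (q1 @ x # b) = w" "hd (q1 @ x # rev a) = w"
    using q(2) q12(1) by (cases q1; simp)+
  show ?thesis
  proof (rule that[of "length q1" "length a"])
    show "length q1 \<le> length a" using p right ab by (auto simp: longest_path_def)
    show "length q1 + length a < length p" using p left ab by (auto simp: longest_path_def)
    fix m assume m: "m < length p"
    show "gdist G w (p ! m) = real (length q1) + \<bar>real (length a) - real m\<bar>"
    \<comment> \<open>From the junction \<open>x\<close> the unique path to \<open>p ! m\<close>
      runs forward along \<open>b\<close> or backward along \<open>a\<close>.\<close>
    proof (cases "length a \<le> m")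
      case True
      have "(q1 @ x # b) ! (length q1 + (m - length a)) = p ! m"
        unfolding nth_append_length_plus using True by (simp add: ab nth_append)
      then show ?thesis
        using gdist_vpath_nth[OF right, of "length q1 + (m - length a)"] True m hds ab by simp
    next
      case False
      have "(q1 @ x # rev a) ! (length q1 + (length a - m)) = p ! m"
        unfolding nth_append_length_plus using False by (simp add: ab nth_append rev_nth nth_Cons')
      then show ?thesis
        using gdist_vpath_nth[OF left, of "length q1 + (length a - m)"] False m hds ab by simp
    qed
  next
    assume "length q1 = 0"
    then show "w = p ! length a" using hds ab by simp
  next
    assume "length q1 = 1"
    then obtain y where y: "q1 = [y]" by (auto simp: length_Suc_conv)
    then show "(w, p ! length a) \<in> parcs G"
      using qx hds ab by (auto simp: vpath_def vwalk_def)
  qed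
qed

text \<open>The two ends of \<open>p\<close> suffice as witnesses: they lie at distances
  \<open>h + j\<close> and \<open>h + (length p - 1 - j)\<close> from \<open>w\<close>.\<close>

lemma ecc_ge_attach:
  assumes "longest_path G p" "w \<in> pverts G"
    and "\<And>m. m < length p \<Longrightarrow> gdist G w (p ! m) = real h + \<bar>real j - real m\<bar>" "j < length p"
  shows "ecc G w \<ge> real (h + max j (length p - 1 - j))"
proof -
  have vp: "vpath p (with_proj G)" using assms(1) by (simp add: longest_path_def)
  have "p ! m \<in> pverts G" if "m < length p" for m using vp that by (auto simp: vpath_iff_nth)
  then have "gdist G w (p ! m) \<le> ecc G w" if "m < length p" for m
    using gdist_le_ecc[of "p ! m" w] gdist_sym[of w "p ! m"] assms(2) that by simp
  then have "real h + \<bar>real j - real m\<bar> \<le> ecc G w" if "m < length p" for m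
    using assms(3) that by metis
  from this[of 0] this[of "length p - 1"]
  have "real h + real j \<le> ecc G w" "real h + \<bar>real j - real (length p - 1)\<bar> \<le> ecc G w"
    using assms(4) by (cases p; force)+
  then show ?thesis using assms(4) by (simp add: max_def of_nat_diff)
qed

text \<open>For the upper bound, \<open>h <= j\<close> and \<open>h + j < length p\<close> say that
  no branch reaches farther from \<open>p ! m\<close> than the end of \<open>p\<close> on its
  side.\<close>

lemma ecc_longest_path:
  assumes p: "longest_path G p" and m: "m < length p"
  shows "ecc G (p ! m) = real (max m (length p - 1 - m))"
proof (rule antisym)
  have vp: "vpath p (with_proj G)" using assms(1) by (simp add: longest_path_def)
  then have pm: "p ! m \<in> pverts G" using m by (auto simp: vpath_iff_nth)
  show "ecc G (p ! m) \<le> real (max m (length p - 1 - m))"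
    unfolding ecc_le_iff
  proof
    fix w assume "w \<in> pverts G"
    then obtain j h where "h \<le> j" "h + j < length p" "gdist G w (p ! m) = real h + \<bar>real j - real m\<bar>"
      using attach_to_longest_path[OF p] m by metis
    then show "gdist G w (p ! m) \<le> real (max m (length p - 1 - m))"
      by (auto simp: max_def)
  qed
  obtain j h where jh: "h + j < length p"
    "\<And>i. i < length p \<Longrightarrow> gdist G (p ! m) (p ! i) = real h + \<bar>real j - real i\<bar>"
    using attach_to_longest_path[OF p pm] by metis
  have "gdist G (p ! m) (p ! m) = 0"
    using dist_vpath(2)[of "[p ! m]"] pm by (simp add: vpath_def)
  \<comment> \<open>The vertex \<open>p ! m\<close> is its own junction, so
    \<open>ecc_ge_attach\<close> gives exactly the lower bound.\<close>
  then have "h = 0" "j = m" using jh(2)[OF m] by auto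
  then show "real (max m (length p - 1 - m)) \<le> ecc G (p ! m)"
    using ecc_ge_attach[OF p pm jh(2)] m by simp
qed

text \<open>Off the path \<open>h >= 1\<close>, and the farther end of \<open>p\<close> is at least
  \<open>length p div 2\<close> edges from the junction. Equality on an even path forces
  \<open>h = 1\<close> and a junction in the middle.\<close>

lemma ecc_off_longest_path:
  assumes p: "longest_path G p" and w: "w \<in> pverts G - set p"
  shows "ecc G w \<ge> real (length p div 2) + 1"
    and "length p = 2 * x \<Longrightarrow> ecc G w = real x + 1 \<Longrightarrow>
      (w, p ! (x - 1)) \<in> parcs G \<or> (w, p ! x) \<in> parcs G"
proof -
  have wv: "w \<in> pverts G" using w by auto
  obtain j h where jh: "h \<le> j" "h + j < length p"
    "\<And>m. m < length p \<Longrightarrow> gdist G w (p ! m) = real h + \<bar>real j - real m\<bar>"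
    "h = 0 \<Longrightarrow> w = p ! j" "h = 1 \<Longrightarrow> (w, p ! j) \<in> parcs G"
    by (rule attach_to_longest_path[OF p wv]) blast
  have "p ! j \<in> set p" using jh(2) by simp
  then have h: "h \<noteq> 0" using jh(4) w by auto
  have e: "ecc G w \<ge> real (h + max j (length p - 1 - j))"
    using jh(2) by (intro ecc_ge_attach[OF p wv jh(3)]) auto
  have "length p div 2 + 1 \<le> h + max j (length p - 1 - j)"
    using h jh(2) by (auto simp: max_def)
  then have "real (length p div 2) + 1 \<le> real (h + max j (length p - 1 - j))" by linarith
  then show "ecc G w \<ge> real (length p div 2) + 1" using e by linarith
  assume x: "length p = 2 * x" "ecc G w = real x + 1"
  then have "h + max j (length p - 1 - j) \<le> x + 1" using e by linarith
  then have "h = 1" "j = x - 1 \<or> j = x" using h x(1) jh(2) by (auto simp: max_def split: if_splits)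
  then show "(w, p ! (x - 1)) \<in> parcs G \<or> (w, p ! x) \<in> parcs G" using jh(5) by auto
qed

text \<open>The middle vertex of \<open>p\<close> attains this value, and no vertex, on or off
  \<open>p\<close>, goes below it.\<close>

lemma ecc_center:
  assumes p: "longest_path G p" and v: "v \<in> center G"
  shows "ecc G v = real (length p div 2)"
proof (rule antisym)
  have vp: "vpath p (with_proj G)" using p by (simp add: longest_path_def)
  then have m: "length p div 2 < length p" by (auto simp: vpath_iff_nth)
  then have "p ! (length p div 2) \<in> pverts G" using vp by (auto simp: vpath_iff_nth)
  then have "ecc G v \<le> ecc G (p ! (length p div 2))" using v by (simp add: center_def)
  also have "\<dots> = real (length p div 2)" unfolding ecc_longest_path[OF p m] by (simp add: max_def) linarith
  finally show "ecc G v \<le> real (length p div 2)" .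
  show "real (length p div 2) \<le> ecc G v"
  proof (cases "v \<in> set p")
    case True
    then obtain m where m: "m < length p" "v = p ! m" by (auto simp: in_set_conv_nth)
    have "length p div 2 \<le> max m (length p - 1 - m)" using m(1) by linarith
    then show ?thesis using ecc_longest_path[OF p m(1)] m(2) by simp
  next
    case False
    then show ?thesis using ecc_off_longest_path(1)[OF p, of v] v by (simp add: center_def)
  qed
qed

lemma total_ecc_longest_path:
  assumes p: "longest_path G p"
  shows "total_ecc G = (\<Sum>m<length p. real (max m (length p - 1 - m))) + (\<Sum>w \<in> pverts G - set p. ecc G w)"
proof -
  have vp: "set p \<subseteq> pverts G" "distinct p" using p by (auto simp: longest_path_def vpath_iff_nth)
  have "(\<Sum>w \<in> set p. ecc G w) = (\<Sum>m<length p. ecc G (p ! m))"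
    using vp(2) by (simp add: sum.distinct_set_conv_list sum_list_sum_nth atLeast0LessThan)
  also have "\<dots> = (\<Sum>m<length p. real (max m (length p - 1 - m)))"
    by (intro sum.cong refl) (simp add: ecc_longest_path[OF p])
  finally show ?thesis
    unfolding total_ecc_def using sum.subset_diff[OF vp(1) pair_finite_verts, of "ecc G"] by simp
qed

lemma card_off_longest_path:
  assumes p: "longest_path G p"
  shows "real (card (pverts G - set p)) = real (card (pverts G)) - real (length p)"
proof -
  have vp: "set p \<subseteq> pverts G" "distinct p" using p by (auto simp: longest_path_def vpath_iff_nth)
  then have "length p \<le> card (pverts G)"
    using pair_finite_verts by (auto intro: card_mono simp flip: distinct_card)
  then show ?thesis
    using vp by (simp add: card_Diff_subset distinct_card of_nat_diff)
qed

end

section \<open>The bound and its minimum\<close>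

text \<open>The value of \<open>Ecc / ecc\<close> at the center of the extremal trees of radius \<open>x\<close> on \<open>n\<close> vertices.\<close>

definition ratio_at :: "nat \<Rightarrow> nat \<Rightarrow> real" where
  "ratio_at n x = real n - 3 + real x + real n / real x"

text \<open>These are the contributions of a longest path with an even and an odd number of vertices
  to the total eccentricity, computed by adding one vertex at each end.\<close>

lemma sum_max_path:
  "(\<Sum>m<2 * x. real (max m (2 * x - 1 - m))) = 3 * real x ^ 2 - real x"
  "(\<Sum>m<2 * x + 1. real (max m (2 * x - m))) = 3 * real x ^ 2 + 2 * real x"
proof -
  \<comment> \<open>The two new ends contribute \<open>d + 2\<close> each, and each of the
    \<open>d + 1\<close> old terms grows by 1.\<close>
  have step: "(\<Sum>m<d + 3. real (max m (d + 2 - m))) = (\<Sum>m<d + 1. real (max m (d - m))) + 3 * real d + 5" for d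
  proof -
    define F where "F m = real (max m (d + 2 - m))" for m
    have "(\<Sum>m<d + 3. F m) = (\<Sum>m<Suc (Suc (d + 1)). F m)" by (simp add: numeral_3_eq_3)
    also have "\<dots> = F 0 + (\<Sum>m<d + 1. F (Suc m)) + F (Suc (d + 1))"
      unfolding sum.lessThan_Suc_shift[of F "Suc (d + 1)"] sum.lessThan_Suc[of _ "d + 1"] by simp
    finally have "(\<Sum>m<d + 3. real (max m (d + 2 - m)))
        = real (d + 2) + (\<Sum>m<d + 1. real (max (Suc m) (d + 2 - Suc m))) + real (d + 2)"
      by (simp add: F_def)
    also have "(\<Sum>m<d + 1. real (max (Suc m) (d + 2 - Suc m))) = (\<Sum>m<d + 1. real (max m (d - m)) + 1)"
      by (intro sum.cong) (auto simp: max_def)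
    finally show ?thesis by (simp add: sum.distrib)
  qed
  show "(\<Sum>m<2 * x. real (max m (2 * x - 1 - m))) = 3 * real x ^ 2 - real x"
  proof (cases x)
    case (Suc y)
    have "(\<Sum>m<2 * y + 2. real (max m (2 * y + 1 - m))) = 3 * real (Suc y) ^ 2 - real (Suc y)"
    proof (induction y)
      case 0
      then show ?case by (simp add: numeral_2_eq_2)
    next
      case (Suc y)
      then show ?case using step[of "2 * y + 1"]
        by (simp add: algebra_simps power2_eq_square numeral_eq_Suc)
    qed
    then show ?thesis using Suc by simp
  qed simp
  show "(\<Sum>m<2 * x + 1. real (max m (2 * x - m))) = 3 * real x ^ 2 + 2 * real x"
  proof (induction x)
    case (Suc x)
    then show ?case using step[of "2 * x"]
      by (simp add: algebra_simps power2_eq_square numeral_eq_Suc)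
  qed simp
qed

section \<open>The ratio of a tree in terms of its radius\<close>

context undirected_tree
begin

lemma ratio_extremal_shape:
  assumes "extremal_shape G x" "x \<ge> 1" "v \<in> center G"
  shows "total_ecc G / ecc G v = ratio_at (card (pverts G)) x"
proof -
  let ?n = "real (card (pverts G))"
  obtain p where p: "longest_path G p" "length p = 2 * x"
    and adj: "\<And>w. w \<in> pverts G - set p \<Longrightarrow> (w, p ! (x - 1)) \<in> parcs G \<or> (w, p ! x) \<in> parcs G"
    using assms(1) by (auto simp: extremal_shape_def)
  \<comment> \<open>Adjacency to a vertex of eccentricity \<open>x\<close> gives the upper bound,
    lying off the longest path the lower one.\<close>
  have "ecc G w = real x + 1" if w: "w \<in> pverts G - set p" for w
  proof (rule antisym)
    have "ecc G (p ! (x - 1)) = real x" "ecc G (p ! x) = real x"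
      using p(2) assms(2) by (simp_all add: ecc_longest_path[OF p(1)] max_def)
    then show "ecc G w \<le> real x + 1" using adj[OF w] ecc_adjacent_le by force
    show "real x + 1 \<le> ecc G w" using ecc_off_longest_path(1)[OF p(1) w] p(2) by simp
  qed
  then have "total_ecc G = 3 * real x ^ 2 - real x + (?n - 2 * real x) * (real x + 1)"
    using total_ecc_longest_path[OF p(1)] card_off_longest_path[OF p(1)] p(2) sum_max_path(1)[of x]
    by simp
  moreover have "ecc G v = real x" using ecc_center[OF p(1) assms(3)] p(2) by simp
  ultimately show ?thesis
    using assms(2) by (simp add: ratio_at_def field_simps power2_eq_square)
qed

text \<open>The witness \<open>x\<close> is the radius of the tree; minimizing over \<open>x\<close>
  is left to \<open>ratio_bound_le\<close>.\<close>

lemma ratio_lower_bound: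
  assumes "card (pverts G) \<ge> 2" "v \<in> center G"
  obtains x where "x \<ge> 1" "total_ecc G / ecc G v \<ge> ratio_at (card (pverts G)) x"
    "total_ecc G / ecc G v = ratio_at (card (pverts G)) x \<Longrightarrow> extremal_shape G x"
proof -
  let ?n = "real (card (pverts G))"
  obtain p where p: "longest_path G p" by (rule longest_path_exists)
  define x where "x = length p div 2"
  let ?U = "pverts G - set p"
  \<comment> \<open>Two distinct vertices yield a path with an edge, so the radius is positive and
    division by it is harmless.\<close>
  have "\<not> is_singleton (pverts G)" using assms(1) by (auto simp: is_singleton_def)
  then obtain a b where ab: "a \<in> pverts G" "b \<in> pverts G" "a \<noteq> b"
    using pverts_nonempty by (metis all_not_in_conv is_singletonI')
  obtain q where q: "vpath q (with_proj G)" "hd q = a" "last q = b" using ex_vpath ab by metis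
  have "length q \<ge> 2" using q ab(3) by (cases q; cases "tl q") (auto simp: vpath_iff_nth)
  then have "length p \<ge> 2" using p q(1) by (auto simp: longest_path_def)
  then have x: "x \<ge> 1" by (simp add: x_def)
  have ev: "ecc G v = real x" using ecc_center[OF p assms(2)] by (simp add: x_def)
  have off: "ecc G w \<ge> real x + 1" if "w \<in> ?U" for w
    using ecc_off_longest_path(1)[OF p that] by (simp add: x_def)
  have sum_off: "(\<Sum>w \<in> ?U. ecc G w) \<ge> (?n - real (length p)) * (real x + 1)"
    using sum_mono[of ?U "\<lambda>_. real x + 1" "ecc G"] off card_off_longest_path[OF p] by simp
  have ratio: "ratio_at (card (pverts G)) x * real x = ?n * real x - 3 * real x + real x ^ 2 + ?n"
    using x by (simp add: ratio_at_def field_simps power2_eq_square)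
  show ?thesis
  proof (cases "even (length p)")
    case True
    then have len: "length p = 2 * x" by (simp add: x_def)
    have tot: "total_ecc G = 3 * real x ^ 2 - real x + (\<Sum>w \<in> ?U. ecc G w)"
      using total_ecc_longest_path[OF p] sum_max_path(1)[of x] len by simp
    show ?thesis
    proof (rule that[OF x])
      show "ratio_at (card (pverts G)) x \<le> total_ecc G / ecc G v"
        using x sum_off tot ratio len by (simp add: ev pos_le_divide_eq algebra_simps power2_eq_square)
      assume "total_ecc G / ecc G v = ratio_at (card (pverts G)) x"
      then have "total_ecc G = ratio_at (card (pverts G)) x * real x"
        using x by (simp add: ev field_simps)
      then have "(\<Sum>w \<in> ?U. ecc G w) = (?n - 2 * real x) * (real x + 1)"
        using tot ratio by (simp add: algebra_simps power2_eq_square)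
      then have "(\<Sum>w \<in> ?U. ecc G w) = (\<Sum>w \<in> ?U. real x + 1)"
        using len card_off_longest_path[OF p] by simp
      \<comment> \<open>All these terms are nonnegative, so each of them vanishes.\<close>
      then have "(\<Sum>w \<in> ?U. ecc G w - (real x + 1)) = 0" by (simp add: sum_subtractf)
      then have "\<forall>w \<in> ?U. ecc G w - (real x + 1) = 0"
        using off pair_finite_verts by (subst (asm) sum_nonneg_eq_0_iff) auto
      then have "\<forall>w \<in> ?U. (w, p ! (x - 1)) \<in> parcs G \<or> (w, p ! x) \<in> parcs G"
        using ecc_off_longest_path(2)[OF p _ len] by auto
      then show "extremal_shape G x" using p len by (auto simp: extremal_shape_def)
    qed
  next
    case False
    then have len: "length p = 2 * x + 1" by (simp add: x_def)
    have tot: "total_ecc G = 3 * real x ^ 2 + 2 * real x + (\<Sum>w \<in> ?U. ecc G w)"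
      using total_ecc_longest_path[OF p] sum_max_path(2)[of x] len by simp
    \<comment> \<open>On an odd path the total exceeds \<open>x\<close> times
      \<open>ratio_at\<close> by at least \<open>2 * x - 1\<close>, so equality never
      occurs.\<close>
    have "ratio_at (card (pverts G)) x < total_ecc G / ecc G v"
      using x sum_off tot ratio len by (simp add: ev pos_less_divide_eq algebra_simps power2_eq_square)
    then show ?thesis using that[OF x] by simp
  qed
qed

end

section \<open>Minimizing \<open>ratio_at\<close> over the positive integers\<close>

lemma ratio_bound_eq:
  assumes "n = k ^ 2 + i" "k \<ge> 1"
  shows "ratio_bound n k i = ratio_at n (if i \<le> k then k else k + 1)"
    "i = k \<Longrightarrow> ratio_at n k = ratio_at n (k + 1)"
proof -
  have "real (k + 1) \<noteq> 0" "real k \<noteq> 0" using assms(2) by auto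
  \<comment> \<open>The second quotient uses \<open>k ^ 2 + i = (k - 1) * (k + 1) + (i + 1)\<close>,
    the origin of the shift to \<open>i + 1\<close>.\<close>
  then have "real n / real k = real k + real i / real k"
    "real n / real (k + 1) = real k - 1 + (real i + 1) / (real k + 1)"
    using assms(1) by (simp_all add: field_simps power2_eq_square)
  then show "ratio_bound n k i = ratio_at n (if i \<le> k then k else k + 1)"
    "i = k \<Longrightarrow> ratio_at n k = ratio_at n (k + 1)"
    using assms by (simp_all add: ratio_bound_def ratio_at_def)
qed

text \<open>The minimizer \<open>y\<close> satisfies \<open>y * (y - 1) < n <= y * (y + 1)\<close>.
  Hence \<open>x * y - n\<close> is negative for \<open>x < y\<close> and nonnegative for
  \<open>x > y\<close>, which fixes the sign of the difference in \<open>diff\<close>. A tie away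
  from \<open>y\<close> needs \<open>n = y * (y + 1)\<close> and \<open>x = y + 1\<close>.\<close>

lemma ratio_bound_le:
  assumes n: "n = k ^ 2 + i" and k: "k \<ge> 1" and i: "i \<le> 2 * k" and x: "x \<ge> 1"
  shows "ratio_bound n k i \<le> ratio_at n x"
    and "ratio_bound n k i = ratio_at n x \<longleftrightarrow> i \<le> k \<and> x = k \<or> k \<le> i \<and> x = k + 1"
proof -
  define y where "y = (if i \<le> k then k else k + 1)"
  have y: "y \<ge> 1" using k by (simp add: y_def)
  have diff: "ratio_at n x - ratio_at n y = (real x - real y) * (real x * real y - real n) / (real x * real y)"
    using x y by (simp add: ratio_at_def field_simps)
  have "ratio_bound n k i = ratio_at n y" using ratio_bound_eq[OF n k] by (simp add: y_def)
  have below: "x * y < n" if "x < y"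
  proof -
    have "(x + 1) * y \<le> y * y" using that by (intro mult_right_mono) auto
    moreover have "y * y < n + y" using n k by (simp add: y_def power2_eq_square)
    ultimately show ?thesis by simp
  qed
  have above: "n \<le> x * y" "n = x * y \<longleftrightarrow> i = k \<and> x = k + 1" if yx: "y < x"
  proof -
    obtain z where z: "x = y + 1 + z" using yx less_iff_Suc_add[of y x] by auto
    then have xy: "x * y = y * y + y + z * y" by (simp add: algebra_simps)
    have le: "n \<le> y * y + y" and eq: "n = y * y + y \<longleftrightarrow> i = k \<and> y = k"
      using n i by (cases "i \<le> k"; auto simp: y_def power2_eq_square)+
    show "n \<le> x * y" using le xy by linarith
    have "n = x * y \<longleftrightarrow> n = y * y + y \<and> z = 0"
    proof (cases "z = 0")
      case False
      then have "z * y > 0" using y by simp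
      then show ?thesis using False le xy by linarith
    qed (simp add: xy)
    then show "n = x * y \<longleftrightarrow> i = k \<and> x = k + 1"
      using eq by (auto simp: z y_def split: if_splits)
  qed
  have pos: "real x * real y > 0" using x y by simp
  consider "x < y" | "x = y" | "x > y" by linarith
  then have "ratio_at n y \<le> ratio_at n x \<and>
    (ratio_at n y = ratio_at n x \<longleftrightarrow> i \<le> k \<and> x = k \<or> k \<le> i \<and> x = k + 1)"
  proof cases
    case 1
    have "real x * real y < real n" using below[OF 1] by (simp flip: of_nat_mult)
    then have "ratio_at n x - ratio_at n y > 0"
      unfolding diff by (intro divide_pos_pos[OF mult_neg_neg pos]) (use 1 in auto)
    then show ?thesis using 1 by (auto simp: y_def split: if_splits)
  next
    case 2
    then show ?thesis using ratio_bound_eq(2)[OF n k] by (auto simp: y_def split: if_splits)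
  next
    case 3
    have "real n \<le> real x * real y" using above(1)[OF 3] by (simp flip: of_nat_mult)
    moreover have "real n = real x * real y \<longleftrightarrow> i = k \<and> x = k + 1"
      using above(2)[OF 3] by (simp flip: of_nat_mult)
    ultimately have "ratio_at n x - ratio_at n y \<ge> 0"
      "ratio_at n x - ratio_at n y = 0 \<longleftrightarrow> i = k \<and> x = k + 1"
      unfolding diff using 3 pos by auto
    then show ?thesis using 3 by (auto simp: y_def split: if_splits)
  qed
  then show "ratio_bound n k i \<le> ratio_at n x"
    "ratio_bound n k i = ratio_at n x \<longleftrightarrow> i \<le> k \<and> x = k \<or> k \<le> i \<and> x = k + 1"
    using \<open>ratio_bound n k i = ratio_at n y\<close> by auto
qed

section \<open>Existence of extremal trees\<close>

text \<open>When \<open>f w < w\<close> for all \<open>0 < w < n\<close>, this is the tree rooted at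
  0 with parent map \<open>f\<close>.\<close>

definition parent_tree :: "nat \<Rightarrow> (nat \<Rightarrow> nat) \<Rightarrow> nat pair_pre_digraph" where
  "parent_tree n f = \<lparr>pverts = {..<n},
     parcs = {(a, b). 0 < a \<and> a < n \<and> b = f a \<or> 0 < b \<and> b < n \<and> a = f b}\<rparr>"

lemma pcas_nth_Suc:
  assumes "pcas u c v" "Suc i < length c"
  shows "fst (c ! Suc i) = snd (c ! i)"
  using assms
proof (induction c arbitrary: u i)
  case (Cons e c)
  then show ?case by (cases i; cases c) auto
qed simp

lemma pcas_ends:
  assumes "pcas u c v" "c \<noteq> []"
  shows "fst (c ! 0) = u" "snd (c ! (length c - 1)) = v"
proof -
  have "fst (c ! 0) = u \<and> snd (c ! (length c - 1)) = v"
    using assms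
  proof (induction c arbitrary: u)
    case (Cons e c)
    then show ?case by (cases c) auto
  qed simp
  then show "fst (c ! 0) = u" "snd (c ! (length c - 1)) = v" by auto
qed

text \<open>Iterated parents decrease to 0, which gives connectedness; a cycle is refuted at its
  largest vertex.\<close>

lemma tree_graph_parent_tree:
  assumes n: "n \<ge> 1" and f: "\<And>w. 0 < w \<Longrightarrow> w < n \<Longrightarrow> f w < w"
  shows "tree_graph (parent_tree n f)"
proof -
  let ?G = "parent_tree n f"
  have arc: "(a, b) \<in> parcs ?G \<longleftrightarrow> 0 < a \<and> a < n \<and> b = f a \<or> 0 < b \<and> b < n \<and> a = f b" for a b
    by (simp add: parent_tree_def)
  have verts: "pverts ?G = {..<n}" by (simp add: parent_tree_def)
  have arc_verts: "a < n \<and> b < n \<and> a \<noteq> b" if "(a, b) \<in> parcs ?G" for a b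
    using that f[of a] f[of b] unfolding arc by auto
  have "finite (parcs ?G)"
    by (rule finite_subset[of _ "{..<n} \<times> {..<n}"]) (use arc_verts in auto)
  moreover have "symmetric (with_proj ?G)" unfolding symmetric_def sym_def by (auto simp: arc)
  moreover have "fst e < n" "snd e < n" "fst e \<noteq> snd e" if "e \<in> parcs ?G" for e
    using arc_verts[of "fst e" "snd e"] that by auto
  ultimately interpret pair_graph ?G by unfold_locales (simp_all add: verts)
  have to_0: "w \<rightarrow>\<^sup>*\<^bsub>with_proj ?G\<^esub> 0" if "w < n" for w
    using that
  proof (induction w rule: less_induct)
    case (less w)
    show ?case
    proof (cases "w = 0")
      case False
      then have "f w \<rightarrow>\<^sup>*\<^bsub>with_proj ?G\<^esub> 0" using less.IH[of "f w"] f[of w] less.prems by simp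
      moreover have "(w, f w) \<in> parcs ?G" using False less.prems by (simp add: arc)
      ultimately show ?thesis by (rule adj_reachable_trans[rotated])
    qed (use n verts in simp)
  qed
  have "a \<rightarrow>\<^sup>*\<^bsub>with_proj ?G\<^esub> b" if "a < n" "b < n" for a b
    using reachable_trans[OF to_0 symmetric_reachable[OF sym_arcs to_0]] that by blast
  then have "connected (with_proj ?G)"
    using n by (auto simp: connected_def strongly_connected_def reachable_mk_symmetric_eq[OF sym_arcs] verts lessThan_empty_iff)
  moreover have False if c: "cycle c" "length c \<ge> 3" for c
  proof -
    have "c \<noteq> []" using c(2) by auto
    obtain u where walk: "pcas u c u" "set c \<subseteq> parcs ?G" and "distinct (tl (pawalk_verts u c))"
      using c(1) by (auto simp: cycle_def awalk_def)
    then have dist: "distinct (map snd c)"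
      using awalk_verts_conv'[of u c u] c(2) by (cases "c = []") auto
    have "Max (snd ` set c) \<in> snd ` set c" using c(2) by (intro Max_in) auto
    then obtain i where i: "i < length c" "snd (c ! i) = Max (snd ` set c)"
      by (auto simp: in_set_conv_nth)
    let ?M = "snd (c ! i)"
    have max: "snd (c ! j) \<le> ?M" if "j < length c" for j
      unfolding i(2) using that by (intro Max_ge) auto
    have lower: "b = f ?M" if "(?M, b) \<in> parcs ?G \<or> (b, ?M) \<in> parcs ?G" "b \<le> ?M" for b
      using that f[of b] unfolding arc by auto
    \<comment> \<open>The largest vertex of the cycle would have two distinct smaller neighbours,
      but its only smaller neighbour is its parent.\<close>
    define j where "j = (if Suc i = length c then 0 else Suc i)"
    define h where "h = (if i = 0 then length c - 1 else i - 1)"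
    \<comment> \<open>The cyclic successor \<open>j\<close> and predecessor \<open>h\<close> of
      \<open>i\<close> differ because the cycle has at least 3 arcs.\<close>
    have jh: "j < length c" "h < length c" "j \<noteq> h" using i(1) c(2) by (auto simp: j_def h_def)
    have "fst (c ! j) = ?M"
    proof (cases "Suc i = length c")
      case True
      then have "i = length c - 1" by simp
      then show ?thesis using pcas_ends[OF walk(1) \<open>c \<noteq> []\<close>] True by (simp add: j_def)
    next
      case False
      then show ?thesis using pcas_nth_Suc[OF walk(1), of i] i(1) by (simp add: j_def)
    qed
    then have "(?M, snd (c ! j)) \<in> parcs ?G"
      using walk(2) jh(1) by (metis nth_mem prod.collapse subsetD)
    then have "snd (c ! j) = f ?M" using lower max jh(1) by blast
    moreover have "fst (c ! i) = snd (c ! h)"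
      using pcas_nth_Suc[OF walk(1), of "i - 1"] pcas_ends[OF walk(1) \<open>c \<noteq> []\<close>] i(1)
      by (auto simp: h_def)
    then have "(snd (c ! h), ?M) \<in> parcs ?G"
      using walk(2) i(1) by (metis nth_mem prod.collapse subsetD)
    then have "snd (c ! h) = f ?M" using lower max jh(2) by blast
    moreover have "snd (c ! j) \<noteq> snd (c ! h)" using dist jh by (simp add: distinct_conv_nth)
    ultimately show False by simp
  qed
  ultimately show ?thesis using pair_graph by (auto simp: tree_graph_def)
qed

text \<open>The path \<open>0, ..., 2 * x - 1\<close> with all further vertices hung at
  \<open>x\<close>, the second of its two center vertices.\<close>

definition broom :: "nat \<Rightarrow> nat \<Rightarrow> nat pair_pre_digraph" where
  "broom n x = parent_tree n (\<lambda>w. if w < 2 * x then w - 1 else x)"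

lemma parcs_broom:
  "(a, b) \<in> parcs (broom n x) \<longleftrightarrow>
     0 < a \<and> a < n \<and> b = (if a < 2 * x then a - 1 else x) \<or>
     0 < b \<and> b < n \<and> a = (if b < 2 * x then b - 1 else x)"
  by (simp add: broom_def parent_tree_def)

lemma pverts_broom: "pverts (broom n x) = {..<n}"
  by (simp add: broom_def parent_tree_def)

text \<open>For \<open>x = 1\<close> the extra vertices would hang at an end of the path and
  lengthen it. For \<open>x >= 2\<close> only \<open>2 * x - 2\<close> vertices can be inner
  vertices of a path, which bounds its length.\<close>

lemma extremal_shape_broom:
  assumes x: "x \<ge> 2" and n: "2 * x \<le> n"
  shows "extremal_shape (broom n x) x"
proof -
  let ?p = "[0..<2 * x]"
  have "vpath ?p (with_proj (broom n x))"
    unfolding vpath_iff_nth pverts_broom parcs_broom using x n by auto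
  moreover have "length q \<le> 2 * x" if q: "vpath q (with_proj (broom n x))" for q
  proof -
    \<comment> \<open>Only the vertices of degree at least 2 can be inner vertices of a path.\<close>
    have inner: "v \<in> {1..<2 * x - 1}"
      if "(u, v) \<in> parcs (broom n x)" "(v, w) \<in> parcs (broom n x)" "u \<noteq> w" for u v w
      using that x unfolding parcs_broom by (auto split: if_splits)
    have "q ! i \<in> {1..<2 * x - 1}" if "i \<in> {1..<length q - 1}" for i
    proof (rule inner)
      show "(q ! (i - 1), q ! i) \<in> parcs (broom n x)" "(q ! i, q ! Suc i) \<in> parcs (broom n x)"
        using q that unfolding vpath_iff_nth by (auto dest: spec[of _ "i - 1"])
      show "q ! (i - 1) \<noteq> q ! Suc i"
        using q that unfolding vpath_iff_nth by (auto simp: nth_eq_iff_index_eq)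
    qed
    moreover have "inj_on ((!) q) {1..<length q - 1}"
      using q by (auto simp: vpath_iff_nth inj_on_def nth_eq_iff_index_eq)
    ultimately have "card {1..<length q - 1} \<le> card {1..<2 * x - 1}"
      by (intro card_inj_on_le[of "(!) q"]) auto
    then show ?thesis using x by simp
  qed
  moreover have "(w, ?p ! x) \<in> parcs (broom n x)" if "w \<in> pverts (broom n x) - set ?p" for w
    using that x unfolding pverts_broom parcs_broom by auto
  ultimately show ?thesis
    unfolding extremal_shape_def longest_path_def by (intro exI[of _ ?p]) auto
qed

lemma tree_graph_broom: "x \<ge> 1 \<Longrightarrow> n \<ge> 1 \<Longrightarrow> tree_graph (broom n x)"
  unfolding broom_def by (rule tree_graph_parent_tree) auto

text \<open>That both values of \<open>x\<close> occur for \<open>i = k\<close> is expressed with a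
  separate tree \<open>S\<close> for each, since the longest paths of one tree all have the same
  length.\<close>

theorem theorem2p2:
  fixes T :: "'a pair_pre_digraph" and n k i :: nat and v :: 'a
  assumes "tree_graph T"
    and "card (pverts T) = n"
    and "n \<ge> 2"
    and "i \<le> 2 * k"
    and "n = k ^ 2 + i"
    and "v \<in> center T"
  shows "total_ecc T / ecc T v \<ge> ratio_bound n k i
    \<and> (n \<ge> 4 \<longrightarrow>
        (total_ecc T / ecc T v = ratio_bound n k i
          \<longleftrightarrow> (\<exists>x. (i \<le> k \<and> x = k \<or> k \<le> i \<and> x = k + 1) \<and> extremal_shape T x)))
    \<and> (i = k \<longrightarrow>
        real n - 3 + 2 * real k + real i / real k
          = real n - 3 + 2 * real k + (real i + 1) / (real k + 1))
    \<and> (n \<ge> 4 \<and> i = k \<longrightarrow>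
        (\<forall>x \<in> {k, k + 1}. \<exists>S :: nat pair_pre_digraph.
          tree_graph S \<and> card (pverts S) = n \<and> extremal_shape S x
          \<and> (\<forall>w \<in> center S. total_ecc S / ecc S w = ratio_bound n k i)))"
proof (intro conjI impI ballI)
  interpret undirected_tree T using assms(1) by (simp add: tree_graph_iff_undirected_tree)
  have k: "k \<ge> 1" using assms(3-5) by (cases k) auto
  note bound = ratio_bound_le[OF assms(5) k assms(4)]
  obtain x where x: "x \<ge> 1" "total_ecc T / ecc T v \<ge> ratio_at n x"
    "total_ecc T / ecc T v = ratio_at n x \<Longrightarrow> extremal_shape T x"
    using ratio_lower_bound[OF _ assms(6)] assms(2,3) by metis
  show "total_ecc T / ecc T v \<ge> ratio_bound n k i"
    using bound(1)[OF x(1)] x(2) by linarith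
  show "total_ecc T / ecc T v = ratio_bound n k i
      \<longleftrightarrow> (\<exists>x. (i \<le> k \<and> x = k \<or> k \<le> i \<and> x = k + 1) \<and> extremal_shape T x)"
  proof
    assume "total_ecc T / ecc T v = ratio_bound n k i"
    \<comment> \<open>Equality collapses the chain
      \<open>ratio_bound n k i <= ratio_at n x <= total_ecc T / ecc T v\<close>.\<close>
    then have "total_ecc T / ecc T v = ratio_at n x" "ratio_bound n k i = ratio_at n x"
      using bound(1)[OF x(1)] x(2) by linarith+
    then show "\<exists>x. (i \<le> k \<and> x = k \<or> k \<le> i \<and> x = k + 1) \<and> extremal_shape T x"
      using bound(2)[OF x(1)] x(3) by blast
  next
    assume "\<exists>x. (i \<le> k \<and> x = k \<or> k \<le> i \<and> x = k + 1) \<and> extremal_shape T x"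
    then obtain y where y: "i \<le> k \<and> y = k \<or> k \<le> i \<and> y = k + 1" "extremal_shape T y" by blast
    then have "y \<ge> 1" using k by auto
    then show "total_ecc T / ecc T v = ratio_bound n k i"
      using ratio_extremal_shape[OF y(2) _ assms(6)] bound(2)[of y] y(1) assms(2) by simp
  qed
next
  assume "i = k"
  moreover have "k \<ge> 1" using assms(3-5) by (cases k) auto
  ultimately show "real n - 3 + 2 * real k + real i / real k
      = real n - 3 + 2 * real k + (real i + 1) / (real k + 1)" by simp
next
  fix x assume *: "n \<ge> 4 \<and> i = k" "x \<in> {k, k + 1}"
  \<comment> \<open>Here \<open>n = k ^ 2 + k\<close>, and \<open>n >= 4\<close> rules out
    \<open>k = 0\<close> and \<open>k = 1\<close>.\<close>
  then have k: "k \<ge> 2" using assms(5) by (cases "k = 0"; cases "k = 1") auto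
  then have "2 * k \<le> k * k" by simp
  \<comment> \<open>This makes room for the longer path, \<open>x = k + 1\<close>, which needs
    \<open>2 * k + 2 <= k * k + k\<close>.\<close>
  then have "k + 2 \<le> k * k" using k by linarith
  then have n: "2 * x \<le> n" using * assms(5) k by (auto simp: power2_eq_square)
  let ?S = "broom n x"
  have S: "tree_graph ?S" "extremal_shape ?S x" "card (pverts ?S) = n"
    using * k n assms(3) tree_graph_broom[of x n] extremal_shape_broom[of x n] by (auto simp: pverts_broom)
  interpret S: undirected_tree ?S using S(1) by (simp add: tree_graph_iff_undirected_tree)
  have "total_ecc ?S / ecc ?S w = ratio_bound n k i" if "w \<in> center ?S" for w
    using S.ratio_extremal_shape[OF S(2) _ that] ratio_bound_le(2)[OF assms(5) _ assms(4), of x] * k S(3)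
    by auto
  then show "\<exists>S :: nat pair_pre_digraph. tree_graph S \<and> card (pverts S) = n \<and> extremal_shape S x
      \<and> (\<forall>w \<in> center S. total_ecc S / ecc S w = ratio_bound n k i)"
    using S by blast
qed

end
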